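(* Let $K$ be a field, let $n\geq 3$ be an integer, let $H$ be a subgroup of $\mathrm{GL}_n(K)$ with $\mathrm{E}_n(K)\leq H\leq \mathrm{GL}_n(K)$, and let $T$ be the $H$-class of $t_{12}(1)$. Let $C$ be a noncentral $H$-class. Then $T\subseteq CC^{-1}CC^{-1}$.
   Context: $t_{ij}(a)=e+ae^{ij}$ ($i\neq j$, $a\in K$) is an elementary transvection, where $e$ is the identity matrix and $e^{ij}$ the matrix unit; $\mathrm{E}_n(K)$ is the subgroup of $\mathrm{GL}_n(K)$ generated by all elementary transvections. For $g\in \mathrm{GL}_n(K)$, the $H$-class of $g$ is $g^H=\{h^{-1}gh\mid h\in H\}$ ($g$ need not lie in $H$); it is noncentral if $g$ is not in the center of $\mathrm{GL}_n(K)$. If $C=g^H$, then $C^{1}:=C$ and $C^{-1}:=(g^{-1})^H$. Products of classes are elementwise products of sets. *)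

theory Defs
  imports
    "HOL-Algebra.Generated_Groups"
    "Jordan_Normal_Form.Gauss_Jordan_Elimination"
begin

definition GL :: "nat \<Rightarrow> 'a :: field mat monoid" where
  "GL n = units_of (ring_mat TYPE('a) n ())"

lemma group_GL: "group (GL n :: 'a :: field mat monoid)"
proof -
  interpret ring "ring_mat TYPE('a) n ()" by (rule ring_mat)
  show ?thesis unfolding GL_def by (rule units_group)
qed

definition matrix_unit :: "nat \<Rightarrow> nat \<Rightarrow> nat \<Rightarrow> 'a :: field mat" where
  "matrix_unit n i j = mat n n (\<lambda>(r, s). if r = i \<and> s = j then 1 else 0)"

(* Rows and columns of matrices are numbered from 0, so t_12(a) is "transvection n 0 1 a".
   The condition that i and j are distinct and below n is imposed where transvections are used. *)
definition transvection :: "nat \<Rightarrow> nat \<Rightarrow> nat \<Rightarrow> 'a :: field \<Rightarrow> 'a mat" where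
  "transvection n i j a = 1\<^sub>m n + a \<cdot>\<^sub>m matrix_unit n i j"

lemma transvection_eq_addrow_mat:
  "i \<noteq> j \<Longrightarrow> transvection n i j a = addrow_mat n a i j"
  by (rule eq_matI) (auto simp: transvection_def matrix_unit_def)

lemma transvection_in_GL:
  "i < n \<Longrightarrow> j < n \<Longrightarrow> i \<noteq> j \<Longrightarrow> transvection n i j a \<in> carrier (GL n)"
  using addrow_mat_Unit[of i n j a "()"]
  by (simp add: transvection_eq_addrow_mat GL_def units_of_carrier)

definition elementary_group :: "nat \<Rightarrow> 'a :: field mat set" where
  "elementary_group n =
     generate (GL n) {transvection n i j a | i j a. i < n \<and> j < n \<and> i \<noteq> j}"

definition center :: "('g, 'b) monoid_scheme \<Rightarrow> 'g set" where
  "center G = {z \<in> carrier G. \<forall>x \<in> carrier G. z \<otimes>\<^bsub>G\<^esub> x = x \<otimes>\<^bsub>G\<^esub> z}"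

definition conj_class :: "('g, 'b) monoid_scheme \<Rightarrow> 'g set \<Rightarrow> 'g \<Rightarrow> 'g set" where
  "conj_class G H g = {inv\<^bsub>G\<^esub> h \<otimes>\<^bsub>G\<^esub> g \<otimes>\<^bsub>G\<^esub> h | h. h \<in> H}"

(* Hence the class of the inverse depends only on the class, not on its representative. *)
lemma (in group) conj_class_inv:
  assumes "subgroup H G" and g: "g \<in> carrier G"
  shows "conj_class G H (inv g) = m_inv G ` conj_class G H g"
proof -
  have "inv (inv h \<otimes> g \<otimes> h) = inv h \<otimes> inv g \<otimes> h" if "h \<in> H" for h
    using subgroup.mem_carrier[OF assms(1) that] g by (simp add: inv_mult_group m_assoc)
  then show ?thesis
    unfolding conj_class_def by (auto simp: image_iff) metis+
qed

end

theory Submission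
  imports Defs
begin

text \<open>Choose an elementary transvection \<open>h\<close> that does not commute with \<open>g\<close>. The commutator
  \<open>y = h\<inverse> g h g\<inverse>\<close> lies in \<open>C C\<inverse>\<close>, and \<open>y - 1\<close> has rank at most two, so for \<open>n \<ge> 3\<close> it has a nonzero
  kernel vector \<open>a\<close>. If \<open>k = 1 + a b\<^sup>T\<close> with \<open>b\<^sup>T a = 0\<close>, then
  \<open>y\<inverse> k\<inverse> y k = 1 - a b\<^sup>T (y - 1)\<close> lies in \<open>C C\<inverse> C C\<inverse>\<close>, and for a suitable choice of \<open>a\<close> and \<open>b\<close> it is
  not the identity. It is then conjugate to \<open>t\<^sub>1\<^sub>2(1)\<close> under the elementary group.\<close>

section \<open>Rank-one matrices, transvections and their conjugation action\<close>

text \<open>The matrix \<open>a w^T\<close>. Vectors are functions on all naturals of which only the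
  values below \<open>n\<close> matter, so that elementary operations become function
  updates.\<close>

definition outer :: "nat \<Rightarrow> (nat \<Rightarrow> 'a :: field) \<Rightarrow> (nat \<Rightarrow> 'a) \<Rightarrow> 'a mat" where
  "outer n a w = mat n n (\<lambda>(i, j). a i * w j)"

lemma outer_carrier [simp]: "outer n a w \<in> carrier_mat n n"
  by (simp add: outer_def)

lemma outer_cong:
  "(\<And>i. i < n \<Longrightarrow> a i = a' i) \<Longrightarrow> (\<And>i. i < n \<Longrightarrow> w i = w' i) \<Longrightarrow> outer n a w = outer n a' w'"
  by (auto simp: outer_def)

lemma mult_outer:
  "A \<in> carrier_mat n n \<Longrightarrow> A * outer n a w = outer n (\<lambda>i. \<Sum>k<n. A $$ (i, k) * a k) w"
  by (rule eq_matI) (auto simp: outer_def scalar_prod_def sum_distrib_right mult.assoc lessThan_atLeast0)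

lemma outer_mult:
  "A \<in> carrier_mat n n \<Longrightarrow> outer n a w * A = outer n a (\<lambda>j. \<Sum>k<n. w k * A $$ (k, j))"
  by (rule eq_matI) (auto simp: outer_def scalar_prod_def sum_distrib_left mult.assoc lessThan_atLeast0)

lemma outer_mult_outer:
  assumes "(\<Sum>k<n. w k * b k) = 0"
  shows "outer n a w * outer n b z = 0\<^sub>m n n"
proof (rule eq_matI)
  fix i j assume "i < dim_row (0\<^sub>m n n :: 'a mat)" "j < dim_col (0\<^sub>m n n :: 'a mat)"
  then have "(outer n a w * outer n b z) $$ (i, j) = (\<Sum>k<n. a i * (w k * b k) * z j)"
    by (simp add: outer_def scalar_prod_def lessThan_atLeast0 mult.assoc)
  also have "\<dots> = 0"
    using assms by (simp flip: sum_distrib_left sum_distrib_right)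
  finally show "(outer n a w * outer n b z) $$ (i, j) = 0\<^sub>m n n $$ (i, j)"
    using \<open>i < _\<close> \<open>j < _\<close> by simp
qed (auto simp: outer_def)

lemma mult_outer_fixed:
  assumes "A \<in> carrier_mat n n" "A *\<^sub>v vec n a = vec n a"
  shows "A * outer n a w = outer n a w"
proof -
  have "(\<Sum>k<n. A $$ (i, k) * a k) = a i" if "i < n" for i
    using arg_cong[OF assms(2), of "\<lambda>v. v $ i"] that assms(1)
    by (simp add: scalar_prod_def lessThan_atLeast0)
  then show ?thesis
    using assms(1) by (auto simp: mult_outer intro: outer_cong)
qed

lemma carrier_GL_mat: "x \<in> carrier (GL n) \<Longrightarrow> x \<in> carrier_mat n n"
  by (auto simp: GL_def units_of_def Units_def ring_mat_def)

lemma mult_GL [simp]: "x \<otimes>\<^bsub>GL n\<^esub> y = x * y"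
  by (simp add: GL_def units_of_def ring_mat_def)

lemma one_GL [simp]: "\<one>\<^bsub>GL n\<^esub> = 1\<^sub>m n"
  by (simp add: GL_def units_of_def ring_mat_def)

lemma inv_GL:
  assumes "x \<in> carrier (GL n)"
  shows "inv\<^bsub>GL n\<^esub> x \<in> carrier_mat n n"
    and "x * inv\<^bsub>GL n\<^esub> x = 1\<^sub>m n" and "inv\<^bsub>GL n\<^esub> x * x = 1\<^sub>m n"
  using assms group.inv_closed[OF group_GL] group.r_inv[OF group_GL] group.l_inv[OF group_GL]
  by (fastforce intro: carrier_GL_mat)+

lemma transvection_carrier [simp]: "transvection n i j a \<in> carrier_mat n n"
  by (simp add: transvection_def matrix_unit_def)

lemma transvection_eq_outer:
  "transvection n i j c = 1\<^sub>m n + outer n (\<lambda>k. if k = i then c else 0) (\<lambda>k. if k = j then 1 else 0)"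
  by (rule eq_matI) (auto simp: transvection_def matrix_unit_def outer_def)

lemma transvection_index:
  "r < n \<Longrightarrow> s < n \<Longrightarrow>
    transvection n i j c $$ (r, s) = (if r = s then 1 else 0) + (if r = i \<and> s = j then c else 0)"
  by (simp add: transvection_def matrix_unit_def)

lemma transvection_row_sum:
  assumes "j < n" "r < n"
  shows "(\<Sum>k<n. transvection n i j c $$ (r, k) * x k) = x r + (if r = i then c * x j else 0)"
proof -
  have "(\<Sum>k<n. transvection n i j c $$ (r, k) * x k) =
      (\<Sum>k<n. (if k = r then x r else 0) + (if k = j then (if r = i then c * x j else 0) else 0))"
    using assms by (intro sum.cong) (auto simp: transvection_index distrib_right)
  then show ?thesis
    using assms by (simp add: sum.distrib)
qed

lemma transvection_column_sum:
  assumes "i < n" "s < n"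
  shows "(\<Sum>k<n. x k * transvection n i j c $$ (k, s)) = x s + (if s = j then c * x i else 0)"
proof -
  have "(\<Sum>k<n. x k * transvection n i j c $$ (k, s)) =
      (\<Sum>k<n. (if k = s then x s else 0) + (if k = i then (if s = j then c * x i else 0) else 0))"
    using assms by (intro sum.cong) (auto simp: transvection_index distrib_left)
  then show ?thesis
    using assms by (simp add: sum.distrib)
qed

lemma transvection_mult_outer:
  assumes "i < n" "j < n"
  shows "transvection n i j c * outer n a w = outer n (a(i := a i + c * a j)) w"
  using assms by (auto simp: mult_outer transvection_row_sum intro: outer_cong)

lemma outer_mult_transvection:
  assumes "i < n" "j < n"
  shows "outer n a w * transvection n i j c = outer n a (w(j := w j + c * w i))"
  using assms by (auto simp: outer_mult transvection_column_sum intro: outer_cong)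

text \<open>The left factor acts on the column \<open>a\<close> by a row operation, the right factor
  on the row \<open>w\<close> by the inverse column operation; this is why \<open>w^T a\<close>
  survives the conjugation.\<close>

lemma transvection_conj_outer:
  assumes ij: "i < n" "j < n" "i \<noteq> j"
  shows "transvection n i j c * (1\<^sub>m n + outer n a w) * inv\<^bsub>GL n\<^esub> (transvection n i j c) =
    1\<^sub>m n + outer n (a(i := a i + c * a j)) (w(j := w j - c * w i))"
proof -
  let ?t = "transvection n i j c"
  let ?B = "1\<^sub>m n + outer n (a(i := a i + c * a j)) (w(j := w j - c * w i))"
  note inv = inv_GL[OF transvection_in_GL[OF ij, of c]]
  have "?t * (1\<^sub>m n + outer n a w) = ?B * ?t"
    using ij by (simp add: mult_add_distrib_mat[of _ n n _ n] add_mult_distrib_mat[of _ n n _ _ n]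
        transvection_mult_outer outer_mult_transvection
        right_mult_one_mat[OF transvection_carrier] left_mult_one_mat[OF transvection_carrier])
  then have "?t * (1\<^sub>m n + outer n a w) * inv\<^bsub>GL n\<^esub> ?t = ?B * (?t * inv\<^bsub>GL n\<^esub> ?t)"
    using inv(1) by (simp add: assoc_mult_mat[of _ n n _ n _ n])
  then show ?thesis
    using inv(2) right_mult_one_mat[of ?B n n] by simp
qed

section \<open>Reduction of \<open>1 + a w^T\<close> to \<open>t_12(1)\<close>\<close>

text \<open>Gaussian elimination for one vector, phrased for an arbitrary invariant \<open>R\<close>
  so that it serves first for the column and then for the row of a rank-one matrix.\<close>

lemma reduce_to_unit:
  fixes x :: "nat \<Rightarrow> 'a :: field"
  assumes S: "finite S" "s \<in> S" "s' \<in> S" "s \<noteq> s'"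
    and R: "R x"
    and step: "\<And>x i j c. R x \<Longrightarrow> i \<in> S \<Longrightarrow> j \<in> S \<Longrightarrow> i \<noteq> j \<Longrightarrow> R (x(i := x i + c * x j))"
    and p: "p \<in> S" "x p \<noteq> 0"
  obtains y where "R y" "y s = 1" "\<And>i. i \<in> S \<Longrightarrow> i \<noteq> s \<Longrightarrow> y i = 0"
proof -
  have one: "\<exists>y. R y \<and> y s = 1" if "R x" "q \<in> S" "q \<noteq> s" "x q \<noteq> 0" for x q
    using step[OF that(1) S(2) that(2), of "(1 - x s) / x q"] that
    by (intro exI[of _ "x(s := x s + (1 - x s) / x q * x q)"]) auto
  obtain z where z: "R z" "z s = 1"
  proof (cases "p = s")
    case False
    then show ?thesis using one[OF R p(1) _ p(2)] that by blast
  next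
    case True
    \<comment> \<open>The entry at \<open>s\<close> cannot be rescaled by itself, so the entry at
      \<open>s'\<close> is first made 1 and then used as the pivot.\<close>
    let ?x = "x(s' := x s' + (1 - x s') / x s * x s)"
    have "R ?x" using step[OF R S(3) S(2)] S(4) by blast
    then show ?thesis using one[of ?x s'] S True p that by auto
  qed
  have "\<exists>y. R y \<and> y s = 1 \<and> (\<forall>i\<in>F. y i = 0)" if "finite F" "F \<subseteq> S - {s}" for F
    using that
  proof (induction F)
    case empty
    then show ?case using z by blast
  next
    case (insert f F)
    then obtain y where y: "R y" "y s = 1" "\<forall>i\<in>F. y i = 0" by auto
    \<comment> \<open>Since \<open>y s = 1\<close>, this is the operation with coefficient
      \<open>- y f\<close>.\<close>
    define y' where "y' = y(f := 0)"
    have "R y'" using step[OF y(1), of f s "- y f"] insert.prems S(2) y(2) by (simp add: y'_def)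
    moreover have "y' s = 1" "\<forall>i\<in>insert f F. y' i = 0"
      using y insert.prems by (auto simp: y'_def)
    ultimately show ?case by blast
  qed
  from this[of "S - {s}"] S(1) that show thesis by auto
qed

text \<open>Conjugations bring \<open>a\<close> to the first unit vector and then \<open>w\<close>
  to the second. The set \<open>X\<close> stays arbitrary because the lemma is applied both to the
  fourfold product of classes and to the complement of \<open>H\<close>.\<close>

lemma transvection_reduction:
  fixes X :: "'a :: field mat set"
  assumes n: "n \<ge> 3"
    and X: "\<And>i j c A. i < n \<Longrightarrow> j < n \<Longrightarrow> i \<noteq> j \<Longrightarrow> A \<in> X \<Longrightarrow>
      transvection n i j c * A * inv\<^bsub>GL n\<^esub> (transvection n i j c) \<in> X"
    and aw: "1\<^sub>m n + outer n a w \<in> X" "(\<Sum>k<n. w k * a k) = 0"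
    and p: "p < n" "a p \<noteq> 0" and q: "q < n" "w q \<noteq> 0"
  shows "transvection n 0 1 1 \<in> X"
proof -
  have step: "1\<^sub>m n + outer n (a(i := a i + c * a j)) (w(j := w j - c * w i)) \<in> X"
    if "1\<^sub>m n + outer n a w \<in> X" "i < n" "j < n" "i \<noteq> j" for i j c a w
    using X[OF that(2-4,1), of c] that by (simp add: transvection_conj_outer)
  \<comment> \<open>Operations on \<open>a\<close> change \<open>w\<close> too, so \<open>w\<close>
    is hidden behind a quantifier and only \<open>w^T a = 0\<close> and \<open>w\<close> being
    nonzero are tracked.\<close>
  define R where "R a \<longleftrightarrow> (\<exists>w. 1\<^sub>m n + outer n a w \<in> X \<and> (\<Sum>k<n. w k * a k) = 0 \<and> (\<exists>q<n. w q \<noteq> 0))"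
    for a
  have "R a" using aw q by (auto simp: R_def)
  have stepR: "R (a(i := a i + c * a j))"
    if "R a" "i \<in> {..<n}" "j \<in> {..<n}" "i \<noteq> j" for a i j c
  proof -
    from that obtain w q where w: "1\<^sub>m n + outer n a w \<in> X" "(\<Sum>k<n. w k * a k) = 0"
      and q: "q < n" "w q \<noteq> 0" by (auto simp: R_def)
    let ?w = "w(j := w j - c * w i)" and ?a = "a(i := a i + c * a j)"
    have "(\<Sum>k<n. ?w k * ?a k) =
      (\<Sum>k<n. w k * a k + (if k = i then w i * c * a j else 0) - (if k = j then w i * c * a j else 0))"
      using that by (intro sum.cong) (auto simp: algebra_simps)
    also have "\<dots> = 0"
      using that w by (simp add: sum.distrib sum_subtractf)
    finally have "(\<Sum>k<n. ?w k * ?a k) = 0" .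
    moreover have "\<exists>q<n. ?w q \<noteq> 0"
    \<comment> \<open>Only entry \<open>j\<close> can change: it does not if \<open>w i = 0\<close>,
      and otherwise entry \<open>i\<close> remains nonzero.\<close>
    proof (cases "w i = 0")
      case True
      then have "?w = w" by auto
      then show ?thesis using q by metis
    next
      case False
      then show ?thesis using that by (intro exI[of _ i]) auto
    qed
    ultimately show ?thesis
      using step[OF w(1), of i j c] that unfolding R_def by blast
  qed
  obtain b where b: "R b" "b 0 = 1" "\<And>i. i \<in> {..<n} \<Longrightarrow> i \<noteq> 0 \<Longrightarrow> b i = 0"
    by (rule reduce_to_unit[of "{..<n}" 0 1 R a p]) (use n p \<open>R a\<close> stepR in auto)
  then obtain w q where w: "1\<^sub>m n + outer n b w \<in> X" "(\<Sum>k<n. w k * b k) = 0"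
    and q: "q < n" "w q \<noteq> 0" by (auto simp: R_def)
  have "(\<Sum>k<n. w k * b k) = (\<Sum>k<n. if k = 0 then w 0 else 0)"
    using b by (intro sum.cong) auto
  then have w0: "w 0 = 0" using w n by simp
  then have q0: "q \<noteq> 0" using q by metis
  \<comment> \<open>Now \<open>b\<close> is frozen: it is the first unit vector, and operations
    among indices from 1 on leave it alone because it vanishes there.\<close>
  define R' where "R' w \<longleftrightarrow> 1\<^sub>m n + outer n b w \<in> X \<and> w 0 = 0" for w
  have stepR': "R' (w(i := w i + c * w j))"
    if "R' w" "i \<in> {1..<n}" "j \<in> {1..<n}" "i \<noteq> j" for w i j c
  proof -
    have "b j = 0" "b i = 0" using that b by auto
    then have "b(j := b j + - c * b i) = b" by auto
    then show ?thesis
      using step[of b w j i "- c"] that by (auto simp: R'_def)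
  qed
  \<comment> \<open>The auxiliary index 2 besides 1 is available because \<open>n\<close> is at
    least 3.\<close>
  obtain v where v: "R' v" "v 1 = 1" "\<And>i. i \<in> {1..<n} \<Longrightarrow> i \<noteq> 1 \<Longrightarrow> v i = 0"
    by (rule reduce_to_unit[of "{1..<n}" 1 2 R' w q]) (use n w q q0 w0 stepR' in \<open>auto simp: R'_def\<close>)
  have v': "v i = (if i = 1 then 1 else 0)" if "i < n" for i
    using v that by (cases "i = 0") (auto simp: R'_def)
  have "transvection n 0 1 1 = 1\<^sub>m n + outer n b v"
    unfolding transvection_eq_outer
    by (intro arg_cong[of _ _ "\<lambda>x. 1\<^sub>m n + x"] outer_cong) (use b v' in auto)
  then show ?thesis using v by (simp add: R'_def)
qed

section \<open>Vectors solving linear conditions\<close>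

text \<open>Two homogeneous equations in at least three unknowns have a nonzero solution; here it is
  supported on two coordinates other than \<open>r\<close>.\<close>

lemma exists_two_equations:
  fixes z :: "nat \<Rightarrow> 'a :: field"
  assumes n: "n \<ge> 3" and r: "r < n"
  obtains a p where "p < n" "a p \<noteq> 0" "a r = 0" "(\<Sum>k<n. z k * a k) = 0"
proof -
  have "\<exists>p q. p < n \<and> q < n \<and> p \<noteq> r \<and> q \<noteq> r \<and> p \<noteq> q"
  proof -
    consider "r = 0" | "r = 1" | "r \<ge> 2" by linarith
    then show ?thesis
    proof cases
      case 1 then show ?thesis using n by (intro exI[of _ 1] exI[of _ 2]) auto
    next
      case 2 then show ?thesis using n by (intro exI[of _ 0] exI[of _ 2]) auto
    next
      case 3 then show ?thesis using n by (intro exI[of _ 0] exI[of _ 1]) auto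
    qed
  qed
  then obtain p q where pq: "p < n" "q < n" "p \<noteq> r" "q \<noteq> r" "p \<noteq> q" by blast
  have sum: "(\<Sum>k<n. z k * (if k = p then \<alpha> else if k = q then \<beta> else 0)) = z p * \<alpha> + z q * \<beta>"
    for \<alpha> \<beta>
  proof -
    have "(\<Sum>k<n. z k * (if k = p then \<alpha> else if k = q then \<beta> else 0)) =
      (\<Sum>k<n. (if k = p then z p * \<alpha> else 0) + (if k = q then z q * \<beta> else 0))"
      using pq by (intro sum.cong) auto
    then show ?thesis using pq by (simp add: sum.distrib)
  qed
  show thesis
  proof (cases "z p = 0")
    case True
    then show thesis
      using that[of p "\<lambda>k. if k = p then 1 else if k = q then 0 else 0"] sum[of 1 0] pq by simp
  next
    case False
    then show thesis
      using that[of q "\<lambda>k. if k = p then z q else if k = q then - z p else 0"]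
        sum[of "z q" "- z p"] pq by (simp add: mult.commute)
  qed
qed

text \<open>The columns killed by every \<open>b\<close> with \<open>b^T a = 0\<close> are exactly
  the multiples of \<open>a\<close>. Hence \<open>a\<close> itself can be kept unless all columns of
  \<open>M\<close> are such multiples, which the vanishing of 2 by 2 minors expresses.\<close>

lemma exists_kernel_pair:
  fixes M :: "'a :: field mat"
  assumes n: "n \<ge> 3" and M: "M \<in> carrier_mat n n" "M \<noteq> 0\<^sub>m n n"
    and a: "p < n" "a p \<noteq> 0" "\<And>i. i < n \<Longrightarrow> (\<Sum>k<n. M $$ (i, k) * a k) = 0"
  obtains a' p' b q where "p' < n" "a' p' \<noteq> 0" "\<And>i. i < n \<Longrightarrow> (\<Sum>k<n. M $$ (i, k) * a' k) = 0"
    "(\<Sum>k<n. b k * a' k) = 0" "q < n" "(\<Sum>k<n. b k * M $$ (k, q)) \<noteq> 0"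
proof (cases "\<exists>r<n. \<exists>s<n. \<exists>q<n. a r * M $$ (s, q) \<noteq> a s * M $$ (r, q)")
  case True
  then obtain r s q where rs: "r < n" "s < n" "q < n" "a r * M $$ (s, q) \<noteq> a s * M $$ (r, q)"
    by blast
  then have "r \<noteq> s" by auto
  \<comment> \<open>This row is \<open>a_r e_s - a_s e_r\<close>: it kills \<open>a\<close>, and its
    product with column \<open>q\<close> is the nonzero minor.\<close>
  let ?b = "\<lambda>k. if k = s then a r else if k = r then - a s else 0"
  have sum: "(\<Sum>k<n. ?b k * x k) = a r * x s - a s * x r" for x
  proof -
    have "(\<Sum>k<n. ?b k * x k) =
      (\<Sum>k<n. (if k = s then a r * x s else 0) - (if k = r then a s * x r else 0))"
      using \<open>r \<noteq> s\<close> by (intro sum.cong) auto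
    then show ?thesis using rs by (simp add: sum_subtractf)
  qed
  show thesis
    by (rule that[of p a ?b q]) (use a rs in \<open>auto simp: sum[of "\<lambda>k. M $$ (k, q)"] sum[of a]\<close>)
next
  \<comment> \<open>Every column of \<open>M\<close> is a multiple of \<open>a\<close>, so \<open>M = a z\<^sup>T\<close> and \<open>a\<close> has to be replaced by a vector
    that is not proportional to it.\<close>
  case False
  define z where "z q = M $$ (p, q) / a p" for q
  have z: "M $$ (s, q) = a s * z q" if "s < n" "q < n" for s q
    using False that a(1,2) by (auto simp: z_def field_simps)
  have "\<exists>s<n. \<exists>q<n. M $$ (s, q) \<noteq> 0"
  proof (rule ccontr)
    assume "\<not> ?thesis"
    then have "M = 0\<^sub>m n n" using M(1) by (intro eq_matI) auto
    then show False using M(2) by simp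
  qed
  then obtain q where q: "q < n" "z q \<noteq> 0" using z by auto
  obtain a' p' where a': "p' < n" "a' p' \<noteq> 0" "a' p = 0" "(\<Sum>k<n. z k * a' k) = 0"
    using exists_two_equations[OF n a(1)] by metis
  have Ma': "(\<Sum>k<n. M $$ (i, k) * a' k) = 0" if "i < n" for i
  proof -
    have "(\<Sum>k<n. M $$ (i, k) * a' k) = (\<Sum>k<n. a i * (z k * a' k))"
      using z that by (intro sum.cong) auto
    then show ?thesis using a'(4) by (simp flip: sum_distrib_left)
  qed
  \<comment> \<open>Here \<open>b\<close> is the unit row at \<open>p\<close>. It kills
    \<open>a'\<close> since \<open>a' p = 0\<close>, while row \<open>p\<close> of \<open>M\<close>
    is \<open>a p\<close> times \<open>z\<close>, which is nonzero at \<open>q\<close>.\<close>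
  have sum: "(\<Sum>k<n. (if k = p then 1 else 0) * x k) = x p" for x :: "nat \<Rightarrow> 'a"
    using a(1) sum.delta[of "{..<n}" p x] by (simp add: if_distrib[of "\<lambda>u. u * _"] cong: if_cong)
  have "(\<Sum>k<n. (if k = p then 1 else 0) * M $$ (k, q)) \<noteq> 0"
    using sum[of "\<lambda>k. M $$ (k, q)"] z[OF a(1) q(1)] a(2) q(2) by simp
  then show thesis
    using a' q(1) sum[of a'] by (intro that[OF a'(1,2) Ma' _ q(1)]) auto
qed

section \<open>Noncentral elements and their commutators with transvections\<close>

text \<open>A matrix commuting with every \<open>t_ij(1)\<close> is scalar, hence central.\<close>

lemma not_central_obtains_transvection:
  fixes g :: "'a :: field mat"
  assumes n: "n \<ge> 2" and g: "g \<in> carrier (GL n)" "g \<notin> center (GL n)"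
  obtains i j where "i < n" "j < n" "i \<noteq> j"
    "transvection n i j 1 * g \<noteq> g * transvection n i j 1"
proof (rule ccontr)
  assume "\<not> thesis"
  with that have comm: "transvection n i j 1 * g = g * transvection n i j 1"
    if "i < n" "j < n" "i \<noteq> j" for i j using that by blast
  have gc: "g \<in> carrier_mat n n" using g(1) by (rule carrier_GL_mat)
  \<comment> \<open>After cancelling \<open>g\<close>, commutation says that
    \<open>e_ij g = g e_ij\<close>; this is its entry at \<open>(r, s)\<close>.\<close>
  have entry: "(if r = i then g $$ (j, s) else 0) = (if s = j then g $$ (r, i) else 0)"
    if ij: "i < n" "j < n" "i \<noteq> j" and rs: "r < n" "s < n" for i j r s
  proof -
    have 1: "(transvection n i j 1 * g) $$ (r, s) = g $$ (r, s) + (if r = i then g $$ (j, s) else 0)"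
      using rs gc ij transvection_row_sum[OF ij(2) rs(1), of i 1 "\<lambda>k. g $$ (k, s)"]
      by (simp add: scalar_prod_def lessThan_atLeast0 carrier_matD[OF transvection_carrier])
    have 2: "(g * transvection n i j 1) $$ (r, s) = g $$ (r, s) + (if s = j then g $$ (r, i) else 0)"
      using rs gc ij transvection_column_sum[OF ij(1) rs(2), of "\<lambda>k. g $$ (r, k)" j 1]
      by (simp add: scalar_prod_def lessThan_atLeast0 carrier_matD[OF transvection_carrier])
    show ?thesis using 1 2 comm[OF ij] by simp
  qed
  have off: "g $$ (j, s) = 0" if js: "j < n" "s < n" "j \<noteq> s" for j s
  proof -
    \<comment> \<open>Any index other than \<open>j\<close> would do; the entry at
      \<open>(i, s)\<close> then gives the claim.\<close>
    define i where "i = (if j = 0 then 1 else 0 :: nat)"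
    have "i < n" "i \<noteq> j" using n by (auto simp: i_def)
    then show ?thesis using entry[of i j i s] js by auto
  qed
  have diag: "g $$ (j, j) = g $$ (0, 0)" if "j < n" for j
    using entry[of 0 j 0 j] n that by (cases "j = 0") auto
  have scalar: "g = g $$ (0, 0) \<cdot>\<^sub>m 1\<^sub>m n"
  proof (rule eq_matI)
    fix r s assume "r < dim_row (g $$ (0, 0) \<cdot>\<^sub>m 1\<^sub>m n)" "s < dim_col (g $$ (0, 0) \<cdot>\<^sub>m 1\<^sub>m n)"
    then show "g $$ (r, s) = (g $$ (0, 0) \<cdot>\<^sub>m 1\<^sub>m n) $$ (r, s)"
      using off[of r s] diag[of r] by (cases "r = s") simp_all
  qed (use gc in auto)
  have "g * x = x * g" if "x \<in> carrier (GL n)" for x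
  proof -
    have x: "x \<in> carrier_mat n n" using that by (rule carrier_GL_mat)
    have "(c \<cdot>\<^sub>m 1\<^sub>m n) * x = x * (c \<cdot>\<^sub>m 1\<^sub>m n)" for c :: 'a
      using x mult_smult_assoc_mat[of "1\<^sub>m n" n n x n c] mult_smult_distrib[of x n n "1\<^sub>m n" n c] by simp
    from this[of "g $$ (0, 0)"] show ?thesis unfolding scalar[symmetric] .
  qed
  then have "g \<in> center (GL n)" using g(1) by (simp add: center_def)
  then show False using g(2) by simp
qed

lemma transvection_fixes:
  assumes "b \<in> carrier_vec n" "j < n" "b $ j = 0"
  shows "transvection n i j c *\<^sub>v b = b"
proof (rule eq_vecI)
  fix r assume "r < dim_vec b"
  then show "(transvection n i j c *\<^sub>v b) $ r = b $ r"
    using assms transvection_row_sum[of j n r i c "\<lambda>k. b $ k"]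
    by (simp add: scalar_prod_def lessThan_atLeast0 carrier_matD[OF transvection_carrier])
qed (use assms in \<open>auto simp: carrier_matD[OF transvection_carrier]\<close>)

lemma inv_fixes:
  assumes "x \<in> carrier (GL n)" "b \<in> carrier_vec n" "x *\<^sub>v b = b"
  shows "inv\<^bsub>GL n\<^esub> x *\<^sub>v b = b"
  using assoc_mult_mat_vec[OF inv_GL(1)[OF assms(1)] carrier_GL_mat[OF assms(1)] assms(2)]
    inv_GL(3)[OF assms(1)] assms(2,3) by simp

text \<open>With \<open>h = t_ij(c)\<close>, choose \<open>a\<close> so that both \<open>a\<close>
  and \<open>g^-1 a\<close> vanish in coordinate \<open>j\<close>. Then \<open>h\<close> fixes both
  vectors, and the four factors return \<open>a\<close> to itself.\<close>

lemma commutator_fixes: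
  fixes g :: "'a :: field mat"
  assumes n: "n \<ge> 3" and g: "g \<in> carrier (GL n)" and ij: "i < n" "j < n" "i \<noteq> j"
  obtains a p where "p < n" "a p \<noteq> 0"
    "(inv\<^bsub>GL n\<^esub> (transvection n i j c) * g * transvection n i j c * inv\<^bsub>GL n\<^esub> g) *\<^sub>v vec n a = vec n a"
proof -
  let ?h = "transvection n i j c" and ?g' = "inv\<^bsub>GL n\<^esub> g"
  obtain a p where a: "p < n" "a p \<noteq> 0" "a j = 0" "(\<Sum>k<n. ?g' $$ (j, k) * a k) = 0"
    using exists_two_equations[OF n ij(2), of "\<lambda>k. ?g' $$ (j, k)"] by metis
  note h = transvection_in_GL[OF ij, of c]
  note [simp] = inv_GL[OF g] carrier_GL_mat[OF g] inv_GL(1)[OF h]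
  have dims: "dim_row ?g' = n" "dim_col ?g' = n" using carrier_matD[OF inv_GL(1)[OF g]] by auto
  have "(?g' *\<^sub>v vec n a) $ j = 0"
    using a ij dims by (simp add: scalar_prod_def lessThan_atLeast0)
  moreover have g'a: "?g' *\<^sub>v vec n a \<in> carrier_vec n"
    by (rule mult_mat_vec_carrier[of _ n n]) auto
  ultimately have 1: "?h *\<^sub>v (?g' *\<^sub>v vec n a) = ?g' *\<^sub>v vec n a"
    using ij(2) by (intro transvection_fixes)
  have 2: "g *\<^sub>v (?g' *\<^sub>v vec n a) = vec n a"
    using assoc_mult_mat_vec[of g n n ?g' n "vec n a"] by simp
  have 3: "inv\<^bsub>GL n\<^esub> ?h *\<^sub>v vec n a = vec n a"
    using a ij by (intro inv_fixes[OF h] transvection_fixes) auto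
  have "(inv\<^bsub>GL n\<^esub> ?h * g * ?h * ?g') *\<^sub>v vec n a
      = inv\<^bsub>GL n\<^esub> ?h *\<^sub>v (g *\<^sub>v (?h *\<^sub>v (?g' *\<^sub>v vec n a)))"
    using g'a by (simp add: assoc_mult_mat_vec[of _ n n _ n] mult_mat_vec_carrier[of _ n n]
        mult_carrier_mat[of _ n n])
  then show thesis using that[of p a] a 1 2 3 by simp
qed

section \<open>Membership in \<open>H\<close> and in products of classes\<close>

lemma transvection_in_elementary:
  "i < n \<Longrightarrow> j < n \<Longrightarrow> i \<noteq> j \<Longrightarrow> transvection n i j c \<in> elementary_group n"
  unfolding elementary_group_def by (rule generate.incl) blast

lemma unipotent_in_subgroup:
  fixes H :: "'a :: field mat set"
  assumes n: "n \<ge> 3" and H: "subgroup H (GL n)" "elementary_group n \<subseteq> H"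
    and ba: "(\<Sum>k<n. b k * a k) = 0" and p: "p < n" "a p \<noteq> 0" and q: "q < n" "b q \<noteq> 0"
  shows "1\<^sub>m n + outer n a b \<in> H"
proof (rule ccontr)
  assume nH: "1\<^sub>m n + outer n a b \<notin> H"
  \<comment> \<open>The complement of \<open>H\<close> is also closed under conjugation by transvections, so the reduction applies to it.\<close>
  have "transvection n 0 1 1 \<in> carrier_mat n n - H"
  proof (rule transvection_reduction[OF n _ _ ba p q])
    fix i j and c :: 'a and A
    assume ij: "i < n" "j < n" "i \<noteq> j" and A: "A \<in> carrier_mat n n - H"
    let ?t = "transvection n i j c"
    have tH: "?t \<in> H" using transvection_in_elementary[OF ij] H(2) by blast
    note inv = inv_GL[OF transvection_in_GL[OF ij, of c]]
    have it: "inv\<^bsub>GL n\<^esub> ?t \<in> H" using subgroup.m_inv_closed[OF H(1) tH] .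
    \<comment> \<open>Conjugating back recovers \<open>A\<close>, so the conjugate cannot lie in
      \<open>H\<close> when \<open>A\<close> does not.\<close>
    have "inv\<^bsub>GL n\<^esub> ?t * (?t * A * inv\<^bsub>GL n\<^esub> ?t) * ?t
        = (inv\<^bsub>GL n\<^esub> ?t * ?t) * A * (inv\<^bsub>GL n\<^esub> ?t * ?t)"
      using A inv(1) by (simp add: assoc_mult_mat[of _ n n _ n _ n] mult_carrier_mat[of _ n n])
    also have "\<dots> = A" using A inv(3) left_mult_one_mat[of A n n] right_mult_one_mat[of A n n] by simp
    finally have "?t * A * inv\<^bsub>GL n\<^esub> ?t \<notin> H"
      using subgroup.m_closed[OF H(1)] tH it A by (metis DiffD2 mult_GL)
    then show "?t * A * inv\<^bsub>GL n\<^esub> ?t \<in> carrier_mat n n - H"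
      using A inv(1) by (auto intro!: mult_carrier_mat[of _ n n])
  qed (use nH in auto)
  then show False using transvection_in_elementary[of 0 n 1] n H(2) by auto
qed

lemma (in group) conj_class_conj:
  assumes H: "subgroup H G" and g: "g \<in> carrier G" and h: "h \<in> H"
    and x: "x \<in> conj_class G H g"
  shows "h \<otimes> x \<otimes> inv h \<in> conj_class G H g"
proof -
  obtain k where k: "k \<in> H" "x = inv k \<otimes> g \<otimes> k" using x by (auto simp: conj_class_def)
  have kh: "h \<in> carrier G" "k \<in> carrier G" using subgroup.mem_carrier[OF H] h k(1) by auto
  have "h \<otimes> x \<otimes> inv h = inv (k \<otimes> inv h) \<otimes> g \<otimes> (k \<otimes> inv h)"
    using kh g k(2) by (simp add: inv_mult_group m_assoc)
  moreover have "k \<otimes> inv h \<in> H"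
    using k(1) h H by (simp add: subgroup.m_closed subgroup.m_inv_closed)
  ultimately show ?thesis unfolding conj_class_def by blast
qed

lemma (in group) set_mult_conj:
  assumes h: "h \<in> carrier G" and AB: "A \<subseteq> carrier G" "B \<subseteq> carrier G"
    and A: "\<And>x. x \<in> A \<Longrightarrow> h \<otimes> x \<otimes> inv h \<in> A"
    and B: "\<And>x. x \<in> B \<Longrightarrow> h \<otimes> x \<otimes> inv h \<in> B"
    and x: "x \<in> A <#>\<^bsub>G\<^esub> B"
  shows "h \<otimes> x \<otimes> inv h \<in> A <#>\<^bsub>G\<^esub> B"
proof -
  obtain a b where ab: "a \<in> A" "b \<in> B" "x = a \<otimes> b" using x by (auto simp: set_mult_def)
  then have c: "a \<in> carrier G" "b \<in> carrier G" using AB by auto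
  have "h \<otimes> x \<otimes> inv h = (h \<otimes> a \<otimes> inv h) \<otimes> (h \<otimes> b \<otimes> inv h)"
  proof -
    have cancel: "inv h \<otimes> (h \<otimes> z) = z" if "z \<in> carrier G" for z
      using that h by (simp flip: m_assoc)
    show ?thesis
      using c h ab(3) by (simp add: m_assoc cancel)
  qed
  then show ?thesis using A[OF ab(1)] B[OF ab(2)] by (auto simp: set_mult_def)
qed

text \<open>Regroup \<open>y^-1\<close> as \<open>g (h^-1 g^-1 h)\<close> and
  \<open>k^-1 y k\<close> as \<open>((hk)^-1 g (hk)) (k^-1 g^-1 k)\<close>; the four factors are
  conjugates by 1, \<open>h\<close>, \<open>hk\<close> and \<open>k\<close>.\<close>

lemma (in group) double_commutator_in_product:
  assumes H: "subgroup H G" and g: "g \<in> carrier G" and h: "h \<in> H" and k: "k \<in> H"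
    and y: "y = inv h \<otimes> g \<otimes> h \<otimes> inv g"
  shows "inv y \<otimes> inv k \<otimes> y \<otimes> k \<in> conj_class G H g <#>\<^bsub>G\<^esub>
    conj_class G H (inv g) <#>\<^bsub>G\<^esub> conj_class G H g <#>\<^bsub>G\<^esub> conj_class G H (inv g)"
proof -
  have hk: "h \<in> carrier G" "k \<in> carrier G" using subgroup.mem_carrier[OF H] h k by auto
  have cl: "inv l \<otimes> x \<otimes> l \<in> conj_class G H x" if "l \<in> H" for l x
    using that by (auto simp: conj_class_def)
  have g1: "g \<in> conj_class G H g"
    using cl[OF subgroup.one_closed[OF H], of g] g by simp
  have hkH: "h \<otimes> k \<in> H" using H h k by (rule subgroup.m_closed)
  have "inv y \<otimes> inv k \<otimes> y \<otimes> k = g \<otimes> (inv h \<otimes> inv g \<otimes> h) \<otimes>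
      (inv (h \<otimes> k) \<otimes> g \<otimes> (h \<otimes> k)) \<otimes> (inv k \<otimes> inv g \<otimes> k)"
  proof -
    have cancel: "k \<otimes> (inv k \<otimes> z) = z" if "z \<in> carrier G" for z
      using that hk by (simp flip: m_assoc)
    show ?thesis
      using hk g by (simp add: y inv_mult_group m_assoc cancel)
  qed
  then show ?thesis
    unfolding set_mult_def using g1 cl[OF h] cl[OF hkH] cl[OF k] by blast
qed

section \<open>A transvection inside the fourfold product of classes\<close>

theorem proposition22:
  fixes n :: nat
    and g :: "'a :: field mat"
    and H T C Cinv :: "'a mat set"
  assumes "n \<ge> 3"
    and "subgroup H (GL n)"
    and "elementary_group n \<subseteq> H"
    and "T = conj_class (GL n) H (transvection n 0 1 1)"
    and "g \<in> carrier (GL n)"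
    and "g \<notin> center (GL n)"
    and "C = conj_class (GL n) H g"
    and "Cinv = conj_class (GL n) H (inv\<^bsub>GL n\<^esub> g)"
  shows "T \<subseteq> C <#>\<^bsub>GL n\<^esub> Cinv <#>\<^bsub>GL n\<^esub> C <#>\<^bsub>GL n\<^esub> Cinv"
proof -
  note n = assms(1) and H = assms(2) and EH = assms(3) and g = assms(5)
  interpret G: group "GL n :: 'a mat monoid" by (rule group_GL)
  let ?X = "C <#>\<^bsub>GL n\<^esub> Cinv <#>\<^bsub>GL n\<^esub> C <#>\<^bsub>GL n\<^esub> Cinv"
  have sub: "conj_class (GL n) H x \<subseteq> carrier (GL n)" if "x \<in> carrier (GL n)" for x
    using that subgroup.mem_carrier[OF H] by (auto simp: conj_class_def simp del: mult_GL)
  have CC: "C \<subseteq> carrier (GL n)" "Cinv \<subseteq> carrier (GL n)"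
    using sub g assms(7,8) by auto
  \<comment> \<open>Each factor is invariant under conjugation by \<open>H\<close>, hence so is the
    product; this supplies the closure that \<open>transvection_reduction\<close> asks for.\<close>
  have X_conj: "h \<otimes>\<^bsub>GL n\<^esub> x \<otimes>\<^bsub>GL n\<^esub> inv\<^bsub>GL n\<^esub> h \<in> ?X" if "h \<in> H" "x \<in> ?X" for h x
  proof -
    have hc: "h \<in> carrier (GL n)" using subgroup.mem_carrier[OF H that(1)] .
    have 1: "h \<otimes>\<^bsub>GL n\<^esub> x \<otimes>\<^bsub>GL n\<^esub> inv\<^bsub>GL n\<^esub> h \<in> C" if "x \<in> C" for x
      using G.conj_class_conj[OF H g \<open>h \<in> H\<close>] that assms(7) by simp
    have 2: "h \<otimes>\<^bsub>GL n\<^esub> x \<otimes>\<^bsub>GL n\<^esub> inv\<^bsub>GL n\<^esub> h \<in> Cinv" if "x \<in> Cinv" for x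
      using G.conj_class_conj[OF H G.inv_closed[OF g] \<open>h \<in> H\<close>] that assms(8) by simp
    note conj = G.set_mult_conj[OF hc]
    show ?thesis
      by (intro conj[OF _ _ _ 2] conj[OF _ _ _ 1] conj[OF _ _ 1 2] G.set_mult_closed CC that(2))
  qed
  obtain i j where ij: "i < n" "j < n" "i \<noteq> j"
    and comm: "transvection n i j 1 * g \<noteq> g * transvection n i j 1"
    using not_central_obtains_transvection[OF _ g assms(6)] n by auto
  define h where "h = (transvection n i j 1 :: 'a mat)"
  have hH: "h \<in> H" using transvection_in_elementary[OF ij] EH by (auto simp: h_def)
  have hc: "h \<in> carrier (GL n)" using subgroup.mem_carrier[OF H hH] .
  define y where "y = inv\<^bsub>GL n\<^esub> h \<otimes>\<^bsub>GL n\<^esub> g \<otimes>\<^bsub>GL n\<^esub> h \<otimes>\<^bsub>GL n\<^esub> inv\<^bsub>GL n\<^esub> g"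
  have yc: "y \<in> carrier (GL n)" using hc g by (simp add: y_def del: mult_GL)
  have ym: "y \<in> carrier_mat n n" using yc by (rule carrier_GL_mat)
  \<comment> \<open>Since \<open>h y g = g h\<close>, a trivial \<open>y\<close> would make
    \<open>h\<close> and \<open>g\<close> commute.\<close>
  have y1: "y \<noteq> 1\<^sub>m n"
  proof
    assume "y = 1\<^sub>m n"
    then have "h \<otimes>\<^bsub>GL n\<^esub> y \<otimes>\<^bsub>GL n\<^esub> g = h \<otimes>\<^bsub>GL n\<^esub> g"
      using carrier_GL_mat[OF hc] by simp
    moreover have "h \<otimes>\<^bsub>GL n\<^esub> y \<otimes>\<^bsub>GL n\<^esub> g = g \<otimes>\<^bsub>GL n\<^esub> h"
    proof -
      have "h \<otimes>\<^bsub>GL n\<^esub> (inv\<^bsub>GL n\<^esub> h \<otimes>\<^bsub>GL n\<^esub> z) = z" if "z \<in> carrier (GL n)" for z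
        using that hc by (simp flip: G.m_assoc del: mult_GL one_GL)
      then show ?thesis using hc g by (simp add: y_def G.m_assoc del: mult_GL one_GL)
    qed
    ultimately show False using comm by (simp add: h_def)
  qed
  obtain a0 p0 where a0: "p0 < n" "a0 p0 \<noteq> 0" "y *\<^sub>v vec n a0 = vec n a0"
    by (rule commutator_fixes[OF n g ij, of 1], rule that) (simp_all add: y_def h_def)
  define M where "M = y - 1\<^sub>m n"
  have Mc: "M \<in> carrier_mat n n" by (simp add: M_def minus_carrier_mat)
  have yM: "y = 1\<^sub>m n + M" using ym by (intro eq_matI) (auto simp: M_def)
  \<comment> \<open>This translates between vectors fixed by \<open>y\<close> and vectors in the
    kernel of \<open>M\<close>.\<close>
  have M_sum: "(\<Sum>k<n. M $$ (r, k) * a k) = (y *\<^sub>v vec n a) $ r - a r" if "r < n" for r a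
  proof -
    have "(\<Sum>k<n. M $$ (r, k) * a k) = (\<Sum>k<n. y $$ (r, k) * a k - (if k = r then a r else 0))"
      using that ym by (intro sum.cong) (auto simp: M_def left_diff_distrib)
    then show ?thesis
      using that ym by (simp add: sum_subtractf scalar_prod_def lessThan_atLeast0)
  qed
  have M0: "M \<noteq> 0\<^sub>m n n" using y1 yM by auto
  have Ma0: "(\<Sum>k<n. M $$ (r, k) * a0 k) = 0" if "r < n" for r
    using M_sum[OF that, of a0] a0(3) that by simp
  obtain a p b q where a: "p < n" "a p \<noteq> 0" "\<And>i. i < n \<Longrightarrow> (\<Sum>k<n. M $$ (i, k) * a k) = 0"
    and b: "(\<Sum>k<n. b k * a k) = 0" "q < n" "(\<Sum>k<n. b k * M $$ (k, q)) \<noteq> 0"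
    by (rule exists_kernel_pair[OF n Mc M0 a0(1,2) Ma0], assumption, rule that)
  have ya: "y *\<^sub>v vec n a = vec n a"
    using M_sum[of _ a] a(3) ym by (intro eq_vecI) auto
  have "\<exists>q<n. b q \<noteq> 0"
  proof (rule ccontr)
    assume "\<not> ?thesis"
    then have "(\<Sum>k<n. b k * M $$ (k, q)) = 0" by (intro sum.neutral) auto
    then show False using b(3) by simp
  qed
  then obtain q' where q': "q' < n" "b q' \<noteq> 0" by blast
  define k where "k = 1\<^sub>m n + outer n a b"
  \<comment> \<open>Membership in \<open>H\<close> is essential: \<open>k\<close> and
    \<open>hk\<close> serve as conjugators in the \<open>H\<close>-classes.\<close>
  have kH: "k \<in> H" unfolding k_def
    by (rule unipotent_in_subgroup[OF n H EH b(1) a(1,2) q'])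
  have kc: "k \<in> carrier (GL n)" using subgroup.mem_carrier[OF H kH] .
  \<comment> \<open>The row \<open>- b^T M\<close>, which makes \<open>z\<close> equal to
    \<open>y^-1 k^-1 y k\<close>.\<close>
  define w where "w j = - (\<Sum>k<n. b k * M $$ (k, j))" for j
  define z where "z = 1\<^sub>m n + outer n a w"
  have zm: "z \<in> carrier_mat n n" by (simp add: z_def)
  have outer_w: "outer n a w = - (outer n a b * M)"
    unfolding outer_mult[OF Mc] by (rule eq_matI) (auto simp: outer_def w_def)
  \<comment> \<open>The commutator identity without inverses. Because \<open>y a = a\<close> and
    \<open>b^T a = 0\<close>, both sides equal \<open>y + a b^T\<close>.\<close>
  have kyz: "y * k = k * y * z"
  proof -
    have 1: "y * outer n a v = outer n a v" for v
      using ym ya by (rule mult_outer_fixed)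
    have 2: "outer n a b * outer n a w = 0\<^sub>m n n"
      using b(1) by (rule outer_mult_outer)
    have oM: "outer n a b * M \<in> carrier_mat n n" using Mc by (intro mult_carrier_mat[of _ n n]) simp
    have yk: "y * k = y + outer n a b"
      using ym 1 by (simp add: k_def mult_add_distrib_mat[of _ n n _ n])
    have ky: "k * y = y + outer n a b + outer n a b * M"
    proof -
      have "k * y = y + outer n a b * y"
        using ym by (simp add: k_def add_mult_distrib_mat[of _ n n _ _ n])
      also have "outer n a b * y = outer n a b + outer n a b * M"
        using Mc by (simp add: yM mult_add_distrib_mat[of _ n n _ n] right_mult_one_mat[OF outer_carrier])
      finally show ?thesis using ym oM by (simp add: assoc_add_mat[of _ n n])
    qed
    have "k * y * outer n a w = k * (y * outer n a w)"
      using ym by (intro assoc_mult_mat[of _ n n _ n _ n]) (auto simp: k_def)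
    also have "\<dots> = outer n a w"
      using 1 2 by (simp add: k_def add_mult_distrib_mat[of _ n n _ _ n] left_mult_one_mat[OF outer_carrier])
    finally have "k * y * z = k * y + outer n a w"
      using ym by (simp add: z_def k_def mult_add_distrib_mat[of _ n n _ n] mult_carrier_mat[of _ n n])
    also have "\<dots> = y + outer n a b"
      unfolding ky outer_w using ym oM
      by (intro eq_matI) (auto simp: carrier_matD[OF outer_carrier])
    finally show ?thesis using yk by simp
  qed
  have "z = inv\<^bsub>GL n\<^esub> y \<otimes>\<^bsub>GL n\<^esub> inv\<^bsub>GL n\<^esub> k \<otimes>\<^bsub>GL n\<^esub> y \<otimes>\<^bsub>GL n\<^esub> k"
  proof -
    note i = inv_GL[OF yc] inv_GL[OF kc]
    note km = carrier_GL_mat[OF kc]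
    have "inv\<^bsub>GL n\<^esub> y * inv\<^bsub>GL n\<^esub> k * y * k = inv\<^bsub>GL n\<^esub> y * inv\<^bsub>GL n\<^esub> k * (k * y * z)"
      using i km ym by (simp add: assoc_mult_mat[of _ n n _ n _ n] mult_carrier_mat[of _ n n] flip: kyz)
    also have "\<dots> = inv\<^bsub>GL n\<^esub> y * ((inv\<^bsub>GL n\<^esub> k * k) * (y * z))"
      using i(1,4) km ym zm by (simp add: assoc_mult_mat[of _ n n _ n _ n] mult_carrier_mat[of _ n n])
    also have "\<dots> = (inv\<^bsub>GL n\<^esub> y * y) * z"
      unfolding i(6) left_mult_one_mat[OF mult_carrier_mat[OF ym zm]]
      using i(1) ym zm by (simp add: assoc_mult_mat[of _ n n _ n _ n])
    also have "\<dots> = z" using i(3) zm by simp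
    finally show ?thesis by simp
  qed
  then have zX: "z \<in> ?X"
    using G.double_commutator_in_product[OF H g hH kH y_def] assms(7,8) by simp
  \<comment> \<open>By associativity \<open>w^T a = - b^T (M a)\<close>, and \<open>a\<close> lies
    in the kernel of \<open>M\<close>.\<close>
  have wa: "(\<Sum>k<n. w k * a k) = 0"
  proof -
    have "(\<Sum>k<n. w k * a k) = - (\<Sum>k<n. \<Sum>l<n. b l * M $$ (l, k) * a k)"
      by (simp add: w_def sum_negf sum_distrib_right)
    also have "(\<Sum>k<n. \<Sum>l<n. b l * M $$ (l, k) * a k) = (\<Sum>l<n. b l * (\<Sum>k<n. M $$ (l, k) * a k))"
      by (subst sum.swap) (simp add: sum_distrib_left mult.assoc)
    also have "\<dots> = 0" using a(3) by simp
    finally show ?thesis by simp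
  qed
  have wq: "w q \<noteq> 0" using b(3) by (simp add: w_def)
  have tX: "transvection n 0 1 1 \<in> ?X"
  proof (rule transvection_reduction[OF n _ _ wa a(1,2) b(2)])
    fix i j c A assume ij: "i < n" "j < n" "i \<noteq> j" and A: "A \<in> ?X"
    have "transvection n i j c \<in> H"
      using transvection_in_elementary[OF ij] EH by blast
    from X_conj[OF this A]
    show "transvection n i j c * A * inv\<^bsub>GL n\<^esub> (transvection n i j c) \<in> ?X"
      unfolding mult_GL .
  next
    show "1\<^sub>m n + outer n a w \<in> ?X" using zX unfolding z_def .
    show "w q \<noteq> 0" by (rule wq)
  qed
  \<comment> \<open>Class elements have the form \<open>l^-1 x l\<close>, so the invariance of the
    product is applied to \<open>l^-1\<close>.\<close>
  have X_T: "inv\<^bsub>GL n\<^esub> l \<otimes>\<^bsub>GL n\<^esub> transvection n 0 1 1 \<otimes>\<^bsub>GL n\<^esub> l \<in> ?X" if "l \<in> H" for l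
    using X_conj[OF subgroup.m_inv_closed[OF H that] tX]
    unfolding G.inv_inv[OF subgroup.mem_carrier[OF H that]] .
  show ?thesis
    unfolding assms(4) conj_class_def using X_T by blast
qed

end
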